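(* Fix a real number $0<\gamma\le 1$ and integers $q\ge 2$ and $1\le s\le t$. Let $m$ be a $(q,s)$-deletion-feasible integer. Then, as $n\to\infty$, \[ \max_{\substack{x,y\in\Sigma_q^n\\ r(x),\,r(y)\le \gamma n\\ |D_s(x)\cap D_s(y)|\le m}} |D_t(x)\cap D_t(y)| = \frac{m\gamma^{t-s}}{(t-s)!}\,n^{t-s}+O_{s,t,m}\!\left(n^{t-s-1}\right). \]
   Context: $\Sigma_q$ is an alphabet of size $q\ge2$, and $\Sigma_q^n$ is the set of sequences of length $n$ over $\Sigma_q$. For sequences $w,x$, write $w\preccurlyeq x$ if $w$ is a (not necessarily contiguous) subsequence of $x$. For $x\in\Sigma_q^n$ and $0\le t\le n$, the $t$-deletion ball is $D_t(x)=\{w\in\Sigma_q^{n-t}: w\preccurlyeq x\}$. $r(x)$ is the number of runs of $x$, i.e. of maximal blocks of consecutive identical symbols. For fixed integers $q\ge2$ and $s\ge1$, a positive integer $m$ is called $(q,s)$-deletion-feasible if there exist an integer $L$ (necessarily $L\ge s$) and two sequences $u,v\in\Sigma_q^L$ such that $D_{s-1}(u)\cap D_{s-1}(v)=\varnothing$ and $|D_s(u)\cap D_s(v)|=m$. $O_{s,t,m}(f(n))$ denotes a quantity bounded in absolute value by $C f(n)$ for all sufficiently large $n$, where $C$ depends only on $s,t,m$ (how large $n$ must be may depend on all the fixed parameters). *)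

theory Defs
  imports Complex_Main "HOL-Library.Sublist"
begin

definition words :: "nat \<Rightarrow> nat \<Rightarrow> nat list set" where
  "words q n = {w. set w \<subseteq> {..<q} \<and> length w = n}"

(* Only meant for t \<le> length x: otherwise the truncated difference is 0 and
   the set is {[]}. *)
definition deletion_ball :: "nat \<Rightarrow> nat \<Rightarrow> nat list \<Rightarrow> nat list set" where
  "deletion_ball q t x = {w \<in> words q (length x - t). subseq w x}"

(* The half-open index interval {i..<j} is a maximal nonempty block of
   equal symbols of x. *)
definition is_run :: "'a list \<Rightarrow> nat \<Rightarrow> nat \<Rightarrow> bool" where
  "is_run x i j \<longleftrightarrow>
     i < j \<and> j \<le> length x \<and> (\<forall>k\<in>{i..<j}. x ! k = x ! i) \<and>
     (i = 0 \<or> x ! (i - 1) \<noteq> x ! i) \<and> (j = length x \<or> x ! j \<noteq> x ! i)"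

definition num_runs :: "'a list \<Rightarrow> nat" where
  "num_runs x = card {(i, j). is_run x i j}"

definition deletion_feasible :: "nat \<Rightarrow> nat \<Rightarrow> nat \<Rightarrow> bool" where
  "deletion_feasible q s m \<longleftrightarrow>
     m > 0 \<and>
     (\<exists>L\<ge>s. \<exists>u\<in>words q L. \<exists>v\<in>words q L.
        deletion_ball q (s - 1) u \<inter> deletion_ball q (s - 1) v = {} \<and>
        card (deletion_ball q s u \<inter> deletion_ball q s v) = m)"

end

(* Upper bound: every common subsequence of x and y extends to a maximal one. The maximal ones
   missing d symbols number at most 4^d: by maximality a common first symbol of x and y is always
   used, and if the first symbols differ then one of them is unused. A word with r runs has at
   most (r + k choose k) subsequences missing k symbols, so extensions missing d > s symbols
   contribute only O(n^(t-s-1)), while those missing at most s symbols pass through one of the at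
   most m words of D_s(x) \<inter> D_s(y).

   Lower bound: append to a feasible pair u, v a common suffix c, namely an alternating binary word
   followed by a constant block that uses up the length without adding runs. Then
   D_s(uc) \<inter> D_s(vc) still has at most m elements, while D_t(uc) \<inter> D_t(vc) has at least
   m |D_(t-s)(c)|. *)

theory Submission
  imports Defs
begin

text \<open>The deletion ball without its alphabet. The additive length condition makes it empty
  when \<open>k\<close> exceeds \<open>length x\<close>, where truncated subtraction would leave
  \<open>[]\<close>.\<close>

definition deletions :: "nat \<Rightarrow> 'a list \<Rightarrow> 'a list set" where
  "deletions k x = {w. subseq w x \<and> length w + k = length x}"

text \<open>Maximal in the subsequence order rather than longest, so these words can have different
  lengths.\<close>

definition maximal_common_subseq :: "'a list \<Rightarrow> 'a list \<Rightarrow> 'a list \<Rightarrow> bool" where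
  "maximal_common_subseq x y w \<longleftrightarrow> subseq w x \<and> subseq w y \<and>
     (\<forall>w'. subseq w' x \<and> subseq w' y \<and> subseq w w' \<longrightarrow> w' = w)"

abbreviation runs :: "'a list \<Rightarrow> nat" where
  "runs x \<equiv> length (remdups_adj x)"

lemma finite_deletions [simp]: "finite (deletions k x)"
  by (rule finite_subset[of _ "set (subseqs x)"]) (auto simp: deletions_def)

text \<open>A subsequence only has letters of \<open>x\<close>, so the alphabet condition is
  automatic; \<open>k \<le> n\<close> makes \<open>length x - k\<close> exact.\<close>

lemma deletion_ball_eq_deletions:
  assumes "x \<in> words q n" "k \<le> n"
  shows "deletion_ball q k x = deletions k x"
proof -
  have "set w \<subseteq> set x" if "subseq w x" for w
    using that by (auto dest: list_emb_set)
  then show ?thesis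
    using assms by (fastforce simp: deletion_ball_def deletions_def words_def)
qed

subsection \<open>Runs\<close>

lemma is_run_end_unique:
  assumes "is_run x i j" "is_run x i j'"
  shows "j = j'"
proof -
  have "\<not> a < b" if "is_run x i a" "is_run x i b" for a b
  proof
    assume "a < b"
    moreover have "i < a" "a = length x \<or> x ! a \<noteq> x ! i" using that(1) unfolding is_run_def by blast+
    moreover have "\<forall>k\<in>{i..<b}. x ! k = x ! i" "b \<le> length x" using that(2) unfolding is_run_def by blast+
    ultimately show False by (metis atLeastLessThan_iff less_imp_le linorder_not_le)
  qed
  then show ?thesis using assms by (meson linorder_neqE_nat)
qed

text \<open>Lets runs be counted by left ends. The right end is the first later position where the
  word stops or the symbol changes.\<close>

lemma is_run_start_iff:
  "(\<exists>j. is_run x i j) \<longleftrightarrow> i < length x \<and> (i = 0 \<or> x ! (i - 1) \<noteq> x ! i)"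
proof
  assume r: "i < length x \<and> (i = 0 \<or> x ! (i - 1) \<noteq> x ! i)"
  let ?P = "\<lambda>j. i < j \<and> (j = length x \<or> x ! j \<noteq> x ! i)"
  define j where "j = (LEAST j. ?P j)"
  have P: "?P (length x)" using r by simp
  have j: "?P j" unfolding j_def by (rule LeastI[of ?P, OF P])
  have jl: "j \<le> length x" unfolding j_def by (rule Least_le[of ?P, OF P])
  have "x ! l = x ! i" if "l \<in> {i..<j}" for l
    using that not_less_Least[of l ?P] j_def by (cases "l = i") auto
  then have "is_run x i j" unfolding is_run_def using j jl r by blast
  then show "\<exists>j. is_run x i j" ..
next
  assume "\<exists>j. is_run x i j"
  then obtain j where "i < j" "j \<le> length x" "i = 0 \<or> x ! (i - 1) \<noteq> x ! i"
    unfolding is_run_def by blast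
  then show "i < length x \<and> (i = 0 \<or> x ! (i - 1) \<noteq> x ! i)" by simp
qed

lemma card_run_starts:
  "card {i. i < length x \<and> (i = 0 \<or> x ! (i - 1) \<noteq> x ! i)} = runs x"
proof (induction x rule: remdups_adj.induct)
  case (2 a)
  have "{i. i < length [a] \<and> (i = 0 \<or> [a] ! (i - 1) \<noteq> [a] ! i)} = {0}" by auto
  then show ?case by simp
next
  case (3 a b x)
  let ?S = "\<lambda>x :: 'a list. {i. i < length x \<and> (i = 0 \<or> x ! (i - 1) \<noteq> x ! i)}"
  have IH: "card (?S (b # x)) = runs (b # x)"
    using 3 by (cases "a = b") auto
  have S0: "?S (b # x) = insert 0 (?S (b # x) - {0})" by auto
  have fin: "finite (?S (b # x))" by simp
  \<comment> \<open>Position 0 always starts a run, and old starts move up by one; the old start 0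
    survives exactly when \<open>a\<close> and \<open>b\<close> differ.\<close>
  have "?S (a # b # x) = insert 0 (Suc ` (if a = b then ?S (b # x) - {0} else ?S (b # x)))"
  proof (rule set_eqI)
    fix i
    show "i \<in> ?S (a # b # x) \<longleftrightarrow>
      i \<in> insert 0 (Suc ` (if a = b then ?S (b # x) - {0} else ?S (b # x)))"
    proof (cases i)
      case (Suc j)
      then show ?thesis by (cases j) (auto simp: image_iff)
    qed auto
  qed
  then have "card (?S (a # b # x)) = Suc (card (if a = b then ?S (b # x) - {0} else ?S (b # x)))"
    by (simp add: card_image)
  also have "\<dots> = runs (a # b # x)"
  proof -
    have "card (?S (b # x)) = Suc (card (?S (b # x) - {0}))"
      using card.remove[OF fin, of 0] by simp
    then show ?thesis using IH by (simp split: if_splits)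
  qed
  finally show ?case .
qed simp

lemma num_runs_eq: "num_runs x = runs x"
proof -
  have "bij_betw fst {(i, j). is_run x i j} {i. \<exists>j. is_run x i j}"
    by (rule bij_betwI') (auto dest: is_run_end_unique)
  then have "num_runs x = card {i. \<exists>j. is_run x i j}"
    unfolding num_runs_def by (rule bij_betw_same_card)
  then show ?thesis unfolding is_run_start_iff card_run_starts .
qed

lemma runs_Cons_Cons: "runs (a # b # x) = (if a = b then 0 else 1) + runs (b # x)"
  by simp

lemma runs_Cons_le: "runs (a # x) \<le> Suc (runs x)"
  by (cases x) auto

lemma runs_le_Cons: "runs x \<le> runs (a # x)"
  by (cases x) auto

lemma runs_append_le: "runs (u @ x) \<le> length u + runs x"
proof (induction u)
  case (Cons a u)
  then show ?case using runs_Cons_le[of a "u @ x"] by simp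
qed simp

text \<open>Prepending a common symbol makes the induction on the embedding go through.\<close>

lemma runs_Cons_subseq_le: "subseq w x \<Longrightarrow> runs (a # w) \<le> runs (a # x)"
proof (induction arbitrary: a rule: list_emb.induct)
  case (list_emb_Nil ys)
  then show ?case using runs_le_Cons[of "a # ys"] by (cases ys) auto
next
  case (list_emb_Cons xs ys y)
  show ?case
  proof (cases "a = y")
    case True
    then show ?thesis using list_emb_Cons.IH[of a] by (simp add: runs_Cons_Cons)
  next
    case False
    \<comment> \<open>\<open>runs (a # ys) \<le> Suc (runs ys) \<le> Suc (runs (y # ys))\<close>,
      and the last term is \<open>runs (a # y # ys)\<close>.\<close>
    then show ?thesis using list_emb_Cons.IH[of a] runs_Cons_le[of a ys] runs_le_Cons[of ys y]
      by (simp add: runs_Cons_Cons)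
  qed
next
  case (list_emb_Cons2 x y xs ys)
  then show ?case using list_emb_Cons2.IH[of y] unfolding runs_Cons_Cons by auto
qed

lemma runs_subseq_le: "subseq w x \<Longrightarrow> runs w \<le> runs x"
proof (induction rule: list_emb.induct)
  case (list_emb_Cons xs ys y)
  then show ?case using runs_le_Cons[of ys y] by simp
next
  case (list_emb_Cons2 x y xs ys)
  then show ?case using runs_Cons_subseq_le[of xs ys y] by (simp del: remdups_adj.simps)
qed simp

subsection \<open>The size of a deletion ball\<close>

text \<open>Match \<open>w\<close> against the leading block letter by letter: once \<open>w\<close>
  fails to continue with \<open>a\<close>, the next block letter is skipped and can be
  removed.\<close>

lemma subseq_replicate_append_cases:
  "subseq w (replicate l a @ y) \<Longrightarrow>
   (\<exists>w'. w = replicate l a @ w' \<and> subseq w' y) \<or> (0 < l \<and> subseq w (replicate (l - 1) a @ y))"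
proof (induction l arbitrary: w)
  case (Suc l)
  show ?case
  proof (cases "\<exists>w1. w = a # w1")
    case True
    then obtain w1 where w: "w = a # w1" by blast
    then have "subseq w1 (replicate l a @ y)" using Suc.prems by simp
    from Suc.IH[OF this] show ?thesis
    proof (elim disjE)
      assume "0 < l \<and> subseq w1 (replicate (l - 1) a @ y)"
      then have "subseq w (replicate l a @ y)" using w by (cases l) auto
      then show ?thesis by simp
    qed (use w in auto)
  next
    case False
    then have "subseq w (replicate l a @ y)"
      using Suc.prems by (cases w) (auto split: if_splits)
    then show ?thesis by simp
  qed
qed simp

text \<open>Split off the first run, \<open>x = replicate l a @ y\<close>. Words that keep it whole
  delete \<open>k\<close> letters from \<open>y\<close>, which has one run fewer; the others delete
  \<open>k - 1\<close> letters from \<open>x\<close> with that run shortened by one. The two bounds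
  add up by Pascal's rule.\<close>

lemma card_deletions_le: "card (deletions k x) \<le> (runs x + k) choose k"
proof (induction "length x + k" arbitrary: x k rule: less_induct)
  case less
  show ?case
  proof (cases x)
    case Nil
    have "deletions k x \<subseteq> {[]}" using Nil by (auto simp: deletions_def)
    then have "card (deletions k x) \<le> card {[] :: 'a list}" by (intro card_mono) auto
    then show ?thesis using Nil by simp
  next
    case (Cons a xs)
    define l where "l = length (takeWhile (\<lambda>b. b = a) x)"
    define y where "y = dropWhile (\<lambda>b. b = a) x"
    have tw: "takeWhile (\<lambda>b. b = a) x = replicate l a"
      unfolding l_def by (rule replicate_eqI[symmetric, THEN sym]) (auto dest: set_takeWhileD)
    have x: "x = replicate l a @ y"
      using takeWhile_dropWhile_id[of "\<lambda>b. b = a" x] unfolding tw y_def by simp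
    have l: "0 < l" unfolding l_def using Cons by simp
    have y: "y = [] \<or> hd y \<noteq> a" unfolding y_def using hd_dropWhile by blast
    \<comment> \<open>\<open>y\<close> does not begin with \<open>a\<close>, so compression does not
      merge across the seam.\<close>
    have "remdups_adj x = remdups_adj (replicate l a) @ remdups_adj y"
      unfolding x using y l by (intro remdups_adj_append') auto
    then have rx: "runs x = Suc (runs y)" using l by (simp add: remdups_adj_replicate)
    have ly: "length y < length x" using x l by simp
    have IHy: "card (deletions k y) \<le> (runs y + k) choose k"
      by (rule less) (use ly in simp)
    show ?thesis
    proof (cases k)
      case 0
      have "deletions k x \<subseteq> {x}" using 0 by (auto simp: deletions_def subseq_same_length)
      then have "card (deletions k x) \<le> card {x}" by (intro card_mono) auto
      then show ?thesis using 0 by simp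
    next
      case (Suc k')
      define z where "z = replicate (l - 1) a @ y"
      have lz: "Suc (length z) = length x" using x l z_def by simp
      have "subseq z x" unfolding x z_def by (cases l) auto
      then have rz: "runs z \<le> runs x" by (rule runs_subseq_le)
      have "card (deletions k' z) \<le> (runs z + k') choose k'"
        by (rule less) (use lz Suc in simp)
      also have "\<dots> \<le> (runs x + k') choose k'" using rz by (intro binomial_right_mono) simp
      finally have IHz: "card (deletions k' z) \<le> (runs x + k') choose k'" .
      have "deletions k x \<subseteq> (\<lambda>w. replicate l a @ w) ` deletions k y \<union> deletions k' z"
      proof
        fix w assume w: "w \<in> deletions k x"
        then have "subseq w (replicate l a @ y)" unfolding deletions_def using x by simp
        from subseq_replicate_append_cases[OF this] w
        show "w \<in> (\<lambda>w. replicate l a @ w) ` deletions k y \<union> deletions k' z"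
          using lz Suc x by (auto simp: deletions_def z_def)
      qed
      then have "card (deletions k x) \<le>
          card ((\<lambda>w. replicate l a @ w) ` deletions k y \<union> deletions k' z)"
        by (intro card_mono) auto
      also have "\<dots> \<le> card ((\<lambda>w. replicate l a @ w) ` deletions k y) + card (deletions k' z)"
        by (rule card_Un_le)
      also have "\<dots> \<le> card (deletions k y) + card (deletions k' z)"
        by (intro add_right_mono card_image_le) simp
      also have "\<dots> \<le> ((runs y + k) choose k) + ((runs x + k') choose k')"
        using IHy IHz by simp
      also have "\<dots> = (runs x + k) choose k" using rx Suc by simp
      finally show ?thesis .
    qed
  qed
qed

section \<open>Alternating words\<close>

fun alternating :: "nat \<Rightarrow> nat \<Rightarrow> nat list" where
  "alternating a 0 = []"
| "alternating a (Suc n) = a # alternating (1 - a) n"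

lemma length_alternating [simp]: "length (alternating a n) = n"
  by (induction n arbitrary: a) auto

lemma set_alternating: "a \<le> 1 \<Longrightarrow> set (alternating a n) \<subseteq> {..<2}"
  by (induction n arbitrary: a) auto

text \<open>Count by first letter: keep \<open>a\<close> and delete \<open>k\<close> of the
  remaining \<open>n - 1\<close> letters, or drop \<open>a\<close>, keep the next letter and delete
  \<open>k - 1\<close> of the remaining \<open>n - 2\<close>. Both tails alternate again, and the
  bounds add up by Pascal's rule. \<open>a \<le> 1\<close> makes \<open>1 - a\<close> a genuine swap
  of 0 and 1.\<close>

lemma card_deletions_alternating:
  "a \<le> 1 \<Longrightarrow> (n - k) choose k \<le> card (deletions k (alternating a n))"
proof (induction n arbitrary: a k rule: less_induct)
  case (less n)
  show ?case
  proof (cases "k = 0 \<or> n < 2 * k")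
    case True
    have "{alternating a n} \<subseteq> deletions 0 (alternating a n)" by (simp add: deletions_def)
    then have "card {alternating a n} \<le> card (deletions 0 (alternating a n))"
      by (rule card_mono[OF finite_deletions])
    moreover have "k = 0 \<or> (n - k) choose k = 0"
      using True by (cases "k = 0") (auto intro: binomial_eq_0)
    ultimately show ?thesis by (elim disjE) (simp_all add: binomial_eq_0)
  next
    case False
    then have kn: "2 * k \<le> n" by simp
    from False obtain k' where k: "k = Suc k'" using not0_implies_Suc by auto
    define n' where "n' = n - 2"
    have n: "n = Suc (Suc n')" using kn k n'_def by simp
    have a: "1 - (1 - a) = a" using less.prems by auto
    have ne: "1 - a \<noteq> a" by arith
    let ?A = "(#) a ` deletions k (alternating (1 - a) (Suc n'))"
    let ?B = "(#) (1 - a) ` deletions k' (alternating a n')"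
    have "?A \<union> ?B \<subseteq> deletions k (alternating a n)"
      unfolding deletions_def n k using a by auto
    then have "card (?A \<union> ?B) \<le> card (deletions k (alternating a n))"
      by (intro card_mono) auto
    moreover have "card (?A \<union> ?B) = card ?A + card ?B"
      using ne by (intro card_Un_disjoint) auto
    moreover have "card ?A = card (deletions k (alternating (1 - a) (Suc n')))"
      by (intro card_image) simp
    moreover have "card ?B = card (deletions k' (alternating a n'))"
      by (intro card_image) simp
    moreover have "(Suc n' - k) choose k \<le> card (deletions k (alternating (1 - a) (Suc n')))"
      by (rule less.IH) (use n in auto)
    moreover have "(n' - k') choose k' \<le> card (deletions k' (alternating a n'))"
      by (rule less.IH) (use n less.prems in auto)
    moreover have "(n - k) choose k = ((Suc n' - k) choose k) + ((n' - k') choose k')"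
    proof -
      have "n - k = Suc (n' - k')" using kn n k by simp
      then show ?thesis using k by simp
    qed
    ultimately show ?thesis by linarith
  qed
qed

section \<open>Deletion balls of concatenations\<close>

lemma deletions_append:
  "v \<in> deletions j x \<Longrightarrow> w \<in> deletions k y \<Longrightarrow> v @ w \<in> deletions (j + k) (x @ y)"
  by (auto simp: deletions_def intro: list_emb_append_mono)

lemma card_deletions_append_right: "card (deletions k x) \<le> card (deletions k (x @ y))"
proof -
  have "y \<in> deletions 0 y" by (simp add: deletions_def)
  then have "(\<lambda>w. w @ y) ` deletions k x \<subseteq> deletions k (x @ y)"
    using deletions_append[of _ k x y 0 y] by auto
  then have "card ((\<lambda>w. w @ y) ` deletions k x) \<le> card (deletions k (x @ y))"
    by (rule card_mono[OF finite_deletions])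
  then show ?thesis by (simp add: card_image inj_on_def)
qed

subsection \<open>Common subsequences\<close>

text \<open>A discrete intermediate value property: between \<open>v\<close> and \<open>w\<close>
  letters can be added one at a time. It cuts a maximal common subsequence down to one with exactly
  \<open>s\<close> missing symbols.\<close>

lemma subseq_interpolate:
  "subseq v w \<Longrightarrow> length v \<le> l \<Longrightarrow> l \<le> length w \<Longrightarrow> \<exists>z. subseq v z \<and> subseq z w \<and> length z = l"
proof (induction arbitrary: l rule: list_emb.induct)
  case (list_emb_Nil ys)
  then show ?case by (intro exI[of _ "take l ys"]) (auto simp: take_is_prefix prefix_imp_subseq)
next
  case (list_emb_Cons xs ys y)
  show ?case
  proof (cases "l \<le> length ys")
    case True
    then show ?thesis using list_emb_Cons by (meson list_emb.list_emb_Cons)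
  next
    case False
    then show ?thesis using list_emb_Cons by (intro exI[of _ "y # ys"]) auto
  qed
next
  case (list_emb_Cons2 x y xs ys)
  then obtain l' where "l = Suc l'" by (cases l) auto
  with list_emb_Cons2 obtain z where "subseq xs z" "subseq z ys" "length z = l'"
    using list_emb_Cons2.IH[of l'] by auto
  then show ?case using \<open>l = Suc l'\<close> list_emb_Cons2 by (intro exI[of _ "y # z"]) auto
qed

section \<open>Maximal common subsequences and their number\<close>

lemma finite_maximal_common_subseqs: "finite {w. maximal_common_subseq x y w \<and> P w}"
  by (rule finite_subset[of _ "set (subseqs x)"]) (auto simp: maximal_common_subseq_def)

text \<open>Take a longest word among the common subsequences containing \<open>z\<close>: every
  common extension of it still contains \<open>z\<close>, so it cannot be longer.\<close>

lemma ex_maximal_common_subseq: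
  assumes "subseq z x" "subseq z y"
  obtains w where "maximal_common_subseq x y w" "subseq z w"
proof -
  let ?P = "\<lambda>w. subseq w x \<and> subseq w y \<and> subseq z w"
  have "\<exists>w. ?P w \<and> (\<forall>w'. ?P w' \<longrightarrow> length w' \<le> length w)"
    by (rule ex_has_greatest_nat[of ?P z length "Suc (length x)"])
      (use assms in \<open>auto simp: less_Suc_eq_le dest: list_emb_length\<close>)
  then obtain w where w: "?P w" and max: "\<And>w'. ?P w' \<Longrightarrow> length w' \<le> length w" by blast
  have "w' = w" if "subseq w' x" "subseq w' y" "subseq w w'" for w'
  proof -
    have "subseq z w'" using w that by (meson subseq_order.order_trans)
    then have "length w' \<le> length w" using max that by blast
    then show ?thesis using that(3) by (metis le_antisym list_emb_length subseq_same_length)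
  qed
  then have "maximal_common_subseq x y w" using w by (auto simp: maximal_common_subseq_def)
  then show ?thesis using that w by blast
qed

text \<open>If \<open>w\<close> skipped the shared first letter it would embed in both tails, and
  \<open>a # w\<close> would extend it. Common extensions of \<open>w'\<close> in the tails become
  ones of \<open>w\<close> by prepending \<open>a\<close>.\<close>

lemma maximal_common_subseq_Cons:
  assumes "maximal_common_subseq (a # x) (a # y) w"
  obtains w' where "w = a # w'" "maximal_common_subseq x y w'"
proof -
  have w: "subseq w (a # x)" "subseq w (a # y)"
    and max: "\<And>w'. subseq w' (a # x) \<Longrightarrow> subseq w' (a # y) \<Longrightarrow> subseq w w' \<Longrightarrow> w' = w"
    using assms by (auto simp: maximal_common_subseq_def)
  have "\<exists>w'. w = a # w'"
  proof (rule ccontr)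
    assume "\<nexists>w'. w = a # w'"
    then have "subseq w x" "subseq w y" using w by (cases w; auto split: if_splits)+
    then have "a # w = w" by (intro max) auto
    then show False by simp
  qed
  then obtain w' where w': "w = a # w'" by blast
  have "v = w'" if "subseq v x" "subseq v y" "subseq w' v" for v
    using max[of "a # v"] that w' by auto
  then have "maximal_common_subseq x y w'" using w w' by (auto simp: maximal_common_subseq_def)
  then show ?thesis using that w' by blast
qed

text \<open>The first letter of \<open>w\<close> differs from \<open>a\<close> or from
  \<open>b\<close>, so one of these is skipped. Maximality passes to the smaller pair, whose common
  subsequences are among those of the larger one.\<close>

lemma maximal_common_subseq_Cons_neq:
  assumes "maximal_common_subseq (a # x) (b # y) w" "a \<noteq> b"
  shows "maximal_common_subseq x (b # y) w \<or> maximal_common_subseq (a # x) y w"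
proof (cases w)
  case Nil
  then show ?thesis using assms by (auto simp: maximal_common_subseq_def)
next
  case (Cons c w')
  then have "subseq w x \<or> subseq w y"
    using assms by (auto simp: maximal_common_subseq_def split: if_splits)
  then show ?thesis using assms by (auto simp: maximal_common_subseq_def)
qed

text \<open>\<open>i\<close> and \<open>j\<close> count the letters missed in \<open>x\<close> and
  in \<open>y\<close>. A shared first letter is used up with both counts unchanged; different first
  letters give two branches, each with one count lowered, hence one factor 2 per missed
  letter.\<close>

lemma card_maximal_common_subseqs_le:
  "card {w. maximal_common_subseq x y w \<and> length w + i = length x \<and> length w + j = length y}
    \<le> 2 ^ (i + j)"
proof (induction "length x + length y" arbitrary: x y i j rule: less_induct)
  case less
  let ?M = "\<lambda>x y i j. {w. maximal_common_subseq x y w \<and> length w + i = length x \<and> length w + j = length y}"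
  show ?case
  proof (cases "x = [] \<or> y = []")
    case True
    then have "?M x y i j \<subseteq> {[]}" by (auto simp: maximal_common_subseq_def)
    then have "card (?M x y i j) \<le> 1" using card_mono[of "{[]}" "?M x y i j"] by simp
    then show ?thesis by (meson le_trans one_le_numeral one_le_power)
  next
    case False
    then obtain a x' b y' where x: "x = a # x'" and y: "y = b # y'"
      by (meson neq_Nil_conv)
    show ?thesis
    proof (cases "a = b")
      case True
      have "?M x y i j \<subseteq> (#) a ` ?M x' y' i j"
        using True x y by (auto elim!: maximal_common_subseq_Cons)
      then have "card (?M x y i j) \<le> card ((#) a ` ?M x' y' i j)"
        by (intro card_mono finite_imageI finite_maximal_common_subseqs)
      also have "\<dots> \<le> card (?M x' y' i j)" by (intro card_image_le finite_maximal_common_subseqs)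
      also have "\<dots> \<le> 2 ^ (i + j)" by (rule less) (use x y in simp)
      finally show ?thesis .
    next
      case False
      \<comment> \<open>\<open>X\<close> collects the candidates that skip the first letter of
        \<open>x\<close>. With \<open>i = 0\<close> no letter can be skipped, and the case split
        guards against the truncated \<open>i - 1\<close>.\<close>
      define X where "X = (if i = 0 then {} else ?M x' y (i - 1) j)"
      define Y where "Y = (if j = 0 then {} else ?M x y' i (j - 1))"
      have "2 * card X \<le> 2 ^ (i + j)"
      proof (cases i)
        case (Suc i')
        have "card (?M x' y i' j) \<le> 2 ^ (i' + j)" by (rule less) (use x in simp)
        then show ?thesis using Suc by (simp add: X_def)
      qed (simp add: X_def)
      moreover have "2 * card Y \<le> 2 ^ (i + j)"
      proof (cases j)
        case (Suc j')
        have "card (?M x y' i j') \<le> 2 ^ (i + j')" by (rule less) (use y in simp)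
        then show ?thesis using Suc by (simp add: Y_def)
      qed (simp add: Y_def)
      moreover have "?M x y i j \<subseteq> X \<union> Y"
      proof
        fix w assume w: "w \<in> ?M x y i j"
        then have "maximal_common_subseq (a # x') (b # y') w" using x y by simp
        from maximal_common_subseq_Cons_neq[OF this False]
        have "maximal_common_subseq x' y w \<or> maximal_common_subseq x y' w" unfolding x y .
        then show "w \<in> X \<union> Y"
        proof
          assume m: "maximal_common_subseq x' y w"
          then have "length w \<le> length x'" by (auto simp: maximal_common_subseq_def dest: list_emb_length)
          then show ?thesis using m w x by (auto simp: X_def)
        next
          assume m: "maximal_common_subseq x y' w"
          then have "length w \<le> length y'" by (auto simp: maximal_common_subseq_def dest: list_emb_length)
          then show ?thesis using m w y by (auto simp: Y_def)
        qed
      qed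
      then have "card (?M x y i j) \<le> card (X \<union> Y)"
        by (rule card_mono[rotated]) (auto simp: X_def Y_def intro!: finite_maximal_common_subseqs)
      ultimately show ?thesis using card_Un_le[of X Y] by linarith
    qed
  qed
qed

text \<open>The index \<open>d\<close> is the number of symbols missed by a maximal common
  subsequence above the given word; all \<open>d \<le> s\<close> are absorbed in the first
  term.\<close>

lemma card_common_deletions_le:
  assumes len: "length x = length y" and st: "s \<le> t"
  shows "card (deletions t x \<inter> deletions t y) \<le>
    card (deletions s x \<inter> deletions s y) * ((runs x + (t - s)) choose (t - s)) +
    (\<Sum>d\<in>{s<..t}. 4 ^ d * ((runs x + (t - d)) choose (t - d)))"
proof -
  let ?M = "\<lambda>d. {w. maximal_common_subseq x y w \<and> length w + d = length x \<and> length w + d = length y}"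
  let ?A = "\<Union>w\<in>deletions s x \<inter> deletions s y. deletions (t - s) w"
  let ?B = "\<lambda>d. \<Union>w\<in>?M d. deletions (t - d) w"
  have bound: "card (deletions k w) \<le> (runs x + k) choose k" if "subseq w x" for w k
  proof -
    have "card (deletions k w) \<le> (runs w + k) choose k" by (rule card_deletions_le)
    also have "\<dots> \<le> (runs x + k) choose k"
      using runs_subseq_le[OF that] by (intro binomial_right_mono) simp
    finally show ?thesis .
  qed
  have "deletions t x \<inter> deletions t y \<subseteq> ?A \<union> (\<Union>d\<in>{s<..t}. ?B d)"
  proof
    fix z assume z: "z \<in> deletions t x \<inter> deletions t y"
    then obtain w where w: "maximal_common_subseq x y w" "subseq z w"
      using ex_maximal_common_subseq unfolding deletions_def by (metis (mono_tags, lifting) IntE mem_Collect_eq)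
    have wxy: "subseq w x" "subseq w y" using w by (auto simp: maximal_common_subseq_def)
    have lz: "length z + t = length x" "length z + t = length y" using z by (auto simp: deletions_def)
    have lw: "length z \<le> length w" "length w \<le> length x" using w(2) wxy list_emb_length by blast+
    show "z \<in> ?A \<union> (\<Union>d\<in>{s<..t}. ?B d)"
    proof (cases "length w + s \<ge> length x")
      case True
      \<comment> \<open>\<open>w\<close> misses at most \<open>s\<close> symbols, so a word missing
        exactly \<open>s\<close> fits between \<open>z\<close> and \<open>w\<close>, and it is again
        common to \<open>x\<close> and \<open>y\<close>.\<close>
      have "length z \<le> length x - s" "length x - s \<le> length w" using True lz(1) st by auto
      then obtain v where v: "subseq z v" "subseq v w" "length v = length x - s"
        using subseq_interpolate[OF w(2)] by blast
      have "v \<in> deletions s x \<inter> deletions s y"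
        using v wxy lz st len by (auto simp: deletions_def intro: subseq_order.order_trans)
      moreover have "z \<in> deletions (t - s) v"
        using v lz st by (auto simp: deletions_def)
      ultimately show ?thesis by blast
    next
      case False
      define d where "d = length x - length w"
      have "d \<in> {s<..t}" using False lz lw by (auto simp: d_def)
      moreover have "w \<in> ?M d" using w lw len by (auto simp: d_def)
      moreover have "z \<in> deletions (t - d) w"
        using w lz lw by (auto simp: deletions_def d_def)
      ultimately show ?thesis by blast
    qed
  qed
  then have "card (deletions t x \<inter> deletions t y) \<le> card (?A \<union> (\<Union>d\<in>{s<..t}. ?B d))"
    by (intro card_mono) (auto intro: finite_maximal_common_subseqs)
  also have "\<dots> \<le> card ?A + card (\<Union>d\<in>{s<..t}. ?B d)" by (rule card_Un_le)
  also have "card ?A \<le> card (deletions s x \<inter> deletions s y) * ((runs x + (t - s)) choose (t - s))"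
  proof -
    have "card ?A \<le> (\<Sum>w\<in>deletions s x \<inter> deletions s y. card (deletions (t - s) w))"
      by (rule card_UN_le) simp
    also have "\<dots> \<le> (\<Sum>w\<in>deletions s x \<inter> deletions s y. (runs x + (t - s)) choose (t - s))"
      by (intro sum_mono bound) (auto simp: deletions_def)
    finally show ?thesis by simp
  qed
  also have "card (\<Union>d\<in>{s<..t}. ?B d) \<le> (\<Sum>d\<in>{s<..t}. 4 ^ d * ((runs x + (t - d)) choose (t - d)))"
  proof -
    have "card (\<Union>d\<in>{s<..t}. ?B d) \<le> (\<Sum>d\<in>{s<..t}. card (?B d))" by (rule card_UN_le) simp
    also have "\<dots> \<le> (\<Sum>d\<in>{s<..t}. 4 ^ d * ((runs x + (t - d)) choose (t - d)))"
    proof (rule sum_mono)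
      fix d
      have "card (?B d) \<le> (\<Sum>w\<in>?M d. card (deletions (t - d) w))"
        by (rule card_UN_le) (rule finite_maximal_common_subseqs)
      also have "\<dots> \<le> (\<Sum>w\<in>?M d. (runs x + (t - d)) choose (t - d))"
        by (intro sum_mono bound) (auto simp: maximal_common_subseq_def)
      also have "\<dots> = card (?M d) * ((runs x + (t - d)) choose (t - d))" by simp
      also have "\<dots> \<le> 4 ^ d * ((runs x + (t - d)) choose (t - d))"
      proof (rule mult_right_mono)
        have "card (?M d) \<le> 2 ^ (d + d)" by (rule card_maximal_common_subseqs_le)
        also have "\<dots> = 4 ^ d" by (simp add: mult_2[symmetric] power_mult)
        finally show "card (?M d) \<le> 4 ^ d" .
      qed simp
      finally show "card (?B d) \<le> 4 ^ d * ((runs x + (t - d)) choose (t - d))" .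
    qed
    finally show ?thesis .
  qed
  finally show ?thesis by simp
qed

subsection \<open>Appending a common suffix\<close>

text \<open>In both words the last symbols of a common subsequence can only use the suffix \<open>c\<close>;
  if \<open>c\<close> were not used completely in both, a longer prefix would be common to \<open>u\<close> and \<open>v\<close>.\<close>

lemma card_common_deletions_append_le:
  assumes lu: "length u = L" and lv: "length v = L" and sL: "s \<le> L" and s: "1 \<le> s"
    and disj: "deletions (s - 1) u \<inter> deletions (s - 1) v = {}"
  shows "card (deletions s (u @ c) \<inter> deletions s (v @ c)) \<le> card (deletions s u \<inter> deletions s v)"
proof -
  have "deletions s (u @ c) \<inter> deletions s (v @ c) \<subseteq> (\<lambda>w. w @ c) ` (deletions s u \<inter> deletions s v)"
  proof
    fix z assume z: "z \<in> deletions s (u @ c) \<inter> deletions s (v @ c)"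
    have lz: "length z = L - s + length c" using z lu sL by (auto simp: deletions_def)
    obtain a a' where a: "z = a @ a'" "subseq a u" "subseq a' c"
      using z by (auto simp: deletions_def elim!: subseq_appendE)
    obtain b b' where b: "z = b @ b'" "subseq b v" "subseq b' c"
      using z by (auto simp: deletions_def elim!: subseq_appendE)
    have la: "length a + length a' = L - s + length c" using a lz by (metis length_append)
    have lb: "length b + length b' = L - s + length c" using b lz by (metis length_append)
    have lac: "length a' \<le> length c" "length b' \<le> length c"
      using a b by (auto dest: list_emb_length)
    have pre: "subseq (take l z) u" if "l \<le> length a" for l
    proof -
      have "take l z = take l a" using a that by simp
      then show ?thesis using a(2) by (metis prefix_imp_subseq subseq_order.order_trans take_is_prefix)
    qed
    have pre': "subseq (take l z) v" if "l \<le> length b" for l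
    proof -
      have "take l z = take l b" using b that by simp
      then show ?thesis using b(2) by (metis prefix_imp_subseq subseq_order.order_trans take_is_prefix)
    qed
    \<comment> \<open>Since \<open>a'\<close> and \<open>b'\<close> are no longer than
      \<open>c\<close>, both \<open>a\<close> and \<open>b\<close> have at least
      \<open>L - s\<close> letters.\<close>
    have w: "take (L - s) z \<in> deletions s u \<inter> deletions s v"
      using pre[of "L - s"] pre'[of "L - s"] la lb lac lz lu lv sL by (auto simp: deletions_def)
    have "length a = L - s \<or> length b = L - s"
    proof (rule ccontr)
      assume "\<not> (length a = L - s \<or> length b = L - s)"
      then have ge: "Suc (L - s) \<le> length a" "Suc (L - s) \<le> length b" using la lb lac by auto
      have "Suc (L - s) \<le> length z" using ge(1) a by simp
      then have "take (Suc (L - s)) z \<in> deletions (s - 1) u \<inter> deletions (s - 1) v"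
        using pre[OF ge(1)] pre'[OF ge(2)] lu lv sL s by (auto simp: deletions_def)
      then show False using disj by blast
    qed
    then have "drop (L - s) z = c"
    proof
      assume "length a = L - s"
      then have "drop (L - s) z = a'" "length a' = length c" using a la by auto
      then show ?thesis using a(3) subseq_same_length by blast
    next
      assume "length b = L - s"
      then have "drop (L - s) z = b'" "length b' = length c" using b lb by auto
      then show ?thesis using b(3) subseq_same_length by blast
    qed
    then have "z = take (L - s) z @ c" by (metis append_take_drop_id)
    then show "z \<in> (\<lambda>w. w @ c) ` (deletions s u \<inter> deletions s v)" using w by blast
  qed
  then have "card (deletions s (u @ c) \<inter> deletions s (v @ c)) \<le>
      card ((\<lambda>w. w @ c) ` (deletions s u \<inter> deletions s v))"
    by (intro card_mono) auto
  also have "\<dots> \<le> card (deletions s u \<inter> deletions s v)" by (intro card_image_le) auto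
  finally show ?thesis .
qed

text \<open>A common subsequence of \<open>u\<close> and \<open>v\<close> is followed by a thinned
  copy of \<open>c\<close>. All first parts have the same length, so both parts can be read back
  from the concatenation.\<close>

lemma card_common_deletions_append_ge:
  "card (deletions s u \<inter> deletions s v) * card (deletions k c)
    \<le> card (deletions (s + k) (u @ c) \<inter> deletions (s + k) (v @ c))"
proof -
  let ?W = "deletions s u \<inter> deletions s v"
  have "inj_on (\<lambda>(w, z). w @ z) (?W \<times> deletions k c)"
    by (auto simp: inj_on_def deletions_def append_eq_append_conv)
  then have "card ?W * card (deletions k c) = card ((\<lambda>(w, z). w @ z) ` (?W \<times> deletions k c))"
    by (simp add: card_image card_cartesian_product)
  also have "\<dots> \<le> card (deletions (s + k) (u @ c) \<inter> deletions (s + k) (v @ c))"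
    by (intro card_mono) (auto intro: deletions_append)
  finally show ?thesis .
qed

text \<open>\<open>R\<close> is the number of runs spent on an alternating prefix, which supplies
  the deletions; the constant padding costs at most one run more.\<close>

lemma ex_word_many_deletions:
  assumes "R \<le> l"
  obtains c where "c \<in> words 2 l" "runs c \<le> Suc R" "(R - k) choose k \<le> card (deletions k c)"
proof -
  define c where "c = alternating 0 R @ replicate (l - R) 0"
  have "c \<in> words 2 l"
    using set_alternating[of 0 R] assms by (auto simp: words_def c_def)
  moreover have "runs c \<le> Suc R"
    using runs_append_le[of "alternating 0 R" "replicate (l - R) (0::nat)"]
    by (simp add: c_def remdups_adj_replicate split: if_splits)
  moreover have "(R - k) choose k \<le> card (deletions k c)"
    using card_deletions_alternating[of 0 R k]
      card_deletions_append_right[of k "alternating 0 R" "replicate (l - R) 0"]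
    by (simp add: c_def)
  ultimately show ?thesis using that by blast
qed

subsection \<open>Asymptotics\<close>

text \<open>For \<open>k \<le> n\<close>, \<open>fact k * (n choose k)\<close> is a falling
  factorial whose \<open>k\<close> factors all exceed \<open>n - k\<close>.\<close>

lemma fact_mult_binomial_ge: "(n - k) ^ k \<le> fact k * (n choose k)"
proof (induction k arbitrary: n)
  case (Suc k)
  have "(n - Suc k) ^ Suc k \<le> n * (n - 1 - k) ^ k" by (simp add: mult_le_mono)
  also have "\<dots> \<le> n * (fact k * ((n - 1) choose k))" by (intro mult_left_mono Suc) simp
  also have "\<dots> = fact k * (Suc k * (n choose Suc k))" by (simp only: binomial_absorption) simp
  finally show ?case by (simp add: algebra_simps)
qed simp

text \<open>A mean value estimate for powers; it turns a bounded shift of the base into an error one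
  order lower.\<close>

lemma power_diff_le:
  fixes a b :: real
  assumes "0 \<le> a" "a \<le> b"
  shows "b ^ k - a ^ k \<le> k * (b - a) * b ^ (k - 1)"
proof (induction k)
  case (Suc k)
  have "b ^ Suc k - a ^ Suc k = b * (b ^ k - a ^ k) + (b - a) * a ^ k" by (simp add: algebra_simps)
  also have "\<dots> \<le> b * (k * (b - a) * b ^ (k - 1)) + (b - a) * b ^ k"
    using assms Suc by (intro add_mono mult_left_mono power_mono) auto
  also have "\<dots> = Suc k * (b - a) * b ^ (Suc k - 1)" by (cases k) (auto simp: algebra_simps)
  finally show ?case .
qed simp

lemma binomial_le_power_real: "real (n choose k) \<le> real n ^ k / fact k"
proof -
  have "fact k * (n choose k) \<le> n ^ k" using binomial_fact_pow[of n k] by (simp add: mult.commute)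
  then have "real (fact k * (n choose k)) \<le> real (n ^ k)" by (simp only: of_nat_le_iff)
  then show ?thesis by (simp add: field_simps)
qed

lemma binomial_le_power: "n choose k \<le> n ^ k"
  by (cases "k \<le> n") (auto simp: binomial_le_pow binomial_eq_0)

text \<open>The first term of \<open>card_common_deletions_le\<close> gives the main term; the terms
  with \<open>d > s\<close> have exponent \<open>t - d\<close>, at most \<open>k - 1\<close>.
  Bounding \<open>\<gamma>\<close> by 1 in the errors keeps their coefficient free of
  \<open>\<gamma>\<close>.\<close>

lemma card_common_deletions_asymp_upper:
  assumes len: "length x = n" "length y = n" and m: "card (deletions s x \<inter> deletions s y) \<le> m"
    and st: "s < t" and nt: "t \<le> n" and \<gamma>: "0 < \<gamma>" "\<gamma> \<le> 1" and r: "real (runs x) \<le> \<gamma> * n"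
  defines "k \<equiv> t - s"
  shows "real (card (deletions t x \<inter> deletions t y)) \<le>
    m * \<gamma> ^ k / fact k * real n ^ k + (m * k * k * 2 ^ k + t * 4 ^ t * 2 ^ t) * real n ^ (k - 1)"
proof -
  have n1: "1 \<le> n" and kn: "k \<le> n" using st nt k_def by auto
  have "real (runs x) \<le> n" using r \<gamma> by (smt (verit) mult_left_le_one_le of_nat_0_le_iff)
  then have rn: "runs x \<le> n" by simp
  have main: "real ((runs x + k) choose k) \<le> \<gamma> ^ k / fact k * real n ^ k + k * k * 2 ^ k * real n ^ (k - 1)"
  proof -
    let ?g = "\<gamma> * real n"
    have "real ((runs x + k) choose k) \<le> real (runs x + k) ^ k / fact k" by (rule binomial_le_power_real)
    also have "\<dots> \<le> (?g + k) ^ k / fact k" using r by (intro divide_right_mono power_mono) auto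
    \<comment> \<open>\<open>power_diff_le\<close> with \<open>b - a = k\<close>, whence
      \<open>k * k\<close>.\<close>
    also have "(?g + k) ^ k \<le> ?g ^ k + k * k * (?g + k) ^ (k - 1)"
      using power_diff_le[of ?g "?g + k" k] \<gamma> by simp
    also have "(?g + k) ^ (k - 1) \<le> (2 * real n) ^ (k - 1)"
    proof (rule power_mono)
      have "?g \<le> n" using \<gamma> by (simp add: mult_left_le_one_le)
      then show "?g + k \<le> 2 * real n" using kn by linarith
    qed (use \<gamma> in simp)
    also have "(2 * real n) ^ (k - 1) \<le> 2 ^ k * real n ^ (k - 1)"
      unfolding power_mult_distrib by (intro mult_right_mono power_increasing) auto
    also have "(?g ^ k + k * k * (2 ^ k * real n ^ (k - 1))) / fact k
        = ?g ^ k / fact k + k * k * (2 ^ k * real n ^ (k - 1)) / fact k"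
      by (simp add: add_divide_distrib)
    also have "\<dots> \<le> ?g ^ k / fact k + k * k * (2 ^ k * real n ^ (k - 1))"
    proof -
      have "z / fact k \<le> z" if "0 \<le> z" for z :: real
      proof -
        have "1 \<le> (fact k :: real)" by (rule fact_ge_1)
        then show ?thesis using that by (simp add: divide_le_eq mult_le_cancel_left1)
      qed
      then show ?thesis by simp
    qed
    finally show ?thesis by (simp add: power_mult_distrib divide_right_mono mult_left_mono)
  qed
  have rest: "(\<Sum>d\<in>{s<..t}. 4 ^ d * ((runs x + (t - d)) choose (t - d))) \<le> t * 4 ^ t * 2 ^ t * n ^ (k - 1)"
  proof -
    have "4 ^ d * ((runs x + (t - d)) choose (t - d)) \<le> 4 ^ t * (2 ^ t * n ^ (k - 1))"
      if d: "d \<in> {s<..t}" for d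
    proof (rule mult_mono)
      show "(4::nat) ^ d \<le> 4 ^ t" using d by (intro power_increasing) auto
      have "(runs x + (t - d)) choose (t - d) \<le> (runs x + (t - d)) ^ (t - d)" by (rule binomial_le_power)
      also have "\<dots> \<le> (2 * n) ^ (t - d)" using rn nt by (intro power_mono) auto
      also have "\<dots> = 2 ^ (t - d) * n ^ (t - d)" by (rule power_mult_distrib)
      also have "\<dots> \<le> 2 ^ t * n ^ (k - 1)"
        using n1 d by (intro mult_mono power_increasing) (auto simp: k_def)
      finally show "(runs x + (t - d)) choose (t - d) \<le> 2 ^ t * n ^ (k - 1)" .
    qed auto
    then have "(\<Sum>d\<in>{s<..t}. 4 ^ d * ((runs x + (t - d)) choose (t - d))) \<le>
        (\<Sum>d\<in>{s<..t}. 4 ^ t * (2 ^ t * n ^ (k - 1)))"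
      by (rule sum_mono)
    also have "\<dots> = (t - s) * (4 ^ t * (2 ^ t * n ^ (k - 1)))" by simp
    also have "\<dots> \<le> t * (4 ^ t * (2 ^ t * n ^ (k - 1)))" by (intro mult_right_mono) auto
    finally show ?thesis by (simp add: mult.assoc)
  qed
  have "card (deletions t x \<inter> deletions t y) \<le>
      card (deletions s x \<inter> deletions s y) * ((runs x + k) choose k) + t * 4 ^ t * 2 ^ t * n ^ (k - 1)"
    using card_common_deletions_le[of x y s t] rest len st unfolding k_def by simp
  also have "\<dots> \<le> m * ((runs x + k) choose k) + t * 4 ^ t * 2 ^ t * n ^ (k - 1)"
    using m by (intro add_right_mono mult_right_mono) auto
  finally have "real (card (deletions t x \<inter> deletions t y)) \<le>
      real (m * ((runs x + k) choose k) + t * 4 ^ t * 2 ^ t * n ^ (k - 1))"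
    by (simp only: of_nat_le_iff)
  also have "\<dots> = m * real ((runs x + k) choose k) + t * 4 ^ t * 2 ^ t * real n ^ (k - 1)" by simp
  also have "\<dots> \<le> m * (\<gamma> ^ k / fact k * real n ^ k + k * k * 2 ^ k * real n ^ (k - 1))
      + t * 4 ^ t * 2 ^ t * real n ^ (k - 1)"
    using main by (intro add_right_mono mult_left_mono) auto
  finally show ?thesis by (simp add: algebra_simps)
qed

text \<open>The witnesses are \<open>u @ c\<close> and \<open>v @ c\<close>, where \<open>c\<close>
  comes from \<open>ex_word_many_deletions\<close> and spends what \<open>u\<close> and
  \<open>v\<close> leave of the run budget.\<close>

lemma ex_common_deletions_asymp_lower:
  fixes \<gamma> :: real
  assumes u: "u \<in> words q L" and v: "v \<in> words q L" and sL: "s \<le> L" and s: "1 \<le> s" and q: "2 \<le> q"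
    and disj: "deletions (s - 1) u \<inter> deletions (s - 1) v = {}"
    and m: "card (deletions s u \<inter> deletions s v) = m"
    and \<gamma>: "0 < \<gamma>" "\<gamma> \<le> 1" and n: "real (L + 2 * k + 2) \<le> \<gamma> * n"
  obtains x y where "x \<in> words q n" "y \<in> words q n" "runs x \<le> \<gamma> * n" "runs y \<le> \<gamma> * n"
    "card (deletions s x \<inter> deletions s y) \<le> m"
    "m * \<gamma> ^ k / fact k * real n ^ k - real (m * k * (L + 2 * k + 2)) * real n ^ (k - 1)
      \<le> card (deletions (s + k) x \<inter> deletions (s + k) y)"
proof -
  let ?g = "\<gamma> * real n"
  \<comment> \<open>\<open>A\<close> bounds the total loss against \<open>\<gamma> * n\<close>: 1 by
    rounding down, \<open>L + 1\<close> for the runs of \<open>u\<close> or \<open>v\<close> and of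
    the padding, and \<open>2 * k\<close> in \<open>R - k - k\<close>.\<close>
  define A where "A = L + 2 * k + 2"
  define F where "F = nat \<lfloor>?g\<rfloor>"
  have F: "real F \<le> ?g" "?g < real F + 1" unfolding F_def using \<gamma> by auto
  have gn: "?g \<le> n" using \<gamma> by (simp add: mult_left_le_one_le)
  have Fn: "F \<le> n" using F gn by linarith
  have FA: "L + 2 * k + 2 \<le> F + 1" using F n by linarith
  \<comment> \<open>Prefix and suffix together then have at most \<open>L + Suc R\<close>, that is
    \<open>F\<close>, runs.\<close>
  define R where "R = F - L - 1"
  have RF: "R + L + 1 = F" using FA R_def by simp
  obtain c where c: "c \<in> words 2 (n - L)" "runs c \<le> Suc R" "(R - k) choose k \<le> card (deletions k c)"
    by (rule ex_word_many_deletions[of R "n - L" k]) (use RF Fn in auto)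
  have Ln: "L \<le> n" using RF Fn by simp
  have wd: "w @ c \<in> words q n" "runs (w @ c) \<le> ?g" if w: "w \<in> words q L" for w
  proof -
    show "w @ c \<in> words q n" using w c q Ln by (auto simp: words_def)
    have "runs (w @ c) \<le> F" using runs_append_le[of w c] w c RF by (auto simp: words_def)
    then show "runs (w @ c) \<le> ?g" using F by linarith
  qed
  have "card (deletions s (u @ c) \<inter> deletions s (v @ c)) \<le> m"
    using card_common_deletions_append_le[of u L v s c] u v sL s disj m by (auto simp: words_def)
  moreover have "m * \<gamma> ^ k / fact k * real n ^ k - real (m * k * (L + 2 * k + 2)) * real n ^ (k - 1)
      \<le> card (deletions (s + k) (u @ c) \<inter> deletions (s + k) (v @ c))"
  proof -
    have gA: "0 \<le> ?g - A" using n unfolding A_def by simp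
    have "real R = real F - L - 1" using RF by linarith
    moreover have "real (R - k - k) \<ge> real R - 2 * k" by linarith
    ultimately have RA: "?g - A \<le> real (R - k - k)" using F unfolding A_def by simp
    have "?g ^ k - real k * A * ?g ^ (k - 1) \<le> (?g - A) ^ k"
      using power_diff_le[of "?g - A" ?g k] gA by simp
    also have "\<dots> \<le> real (R - k - k) ^ k" by (intro power_mono RA gA)
    also have "\<dots> = real ((R - k - k) ^ k)" by simp
    also have "\<dots> \<le> real (fact k * ((R - k) choose k))"
      using fact_mult_binomial_ge[of "R - k" k] by (simp only: of_nat_le_iff)
    also have "\<dots> \<le> fact k * real (card (deletions k c))" using c(3) by simp
    finally have "(?g ^ k - real k * A * ?g ^ (k - 1)) / fact k \<le> card (deletions k c)"
      by (simp add: divide_le_eq mult.commute)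
    moreover have "real k * A * ?g ^ (k - 1) / fact k \<le> real k * A * real n ^ (k - 1)"
    proof -
      have "real k * A * ?g ^ (k - 1) / fact k \<le> real k * A * ?g ^ (k - 1)"
      proof -
        have "0 \<le> real k * A * ?g ^ (k - 1)" using \<gamma> by simp
        moreover have "1 \<le> (fact k :: real)" by (rule fact_ge_1)
        ultimately show ?thesis by (simp add: divide_le_eq mult_le_cancel_left1)
      qed
      \<comment> \<open>Replacing \<open>\<gamma> * n\<close> by \<open>n\<close> removes
        \<open>\<gamma>\<close> from the error coefficient.\<close>
      also have "\<dots> \<le> real k * A * real n ^ (k - 1)"
        using gn \<gamma> by (intro mult_left_mono power_mono) auto
      finally show ?thesis .
    qed
    ultimately have "?g ^ k / fact k - real k * A * real n ^ (k - 1) \<le> card (deletions k c)"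
      by (simp add: diff_divide_distrib)
    then have "m * (?g ^ k / fact k - real k * A * real n ^ (k - 1)) \<le> m * card (deletions k c)"
      by (simp add: mult_left_mono)
    also have "\<dots> \<le> card (deletions (s + k) (u @ c) \<inter> deletions (s + k) (v @ c))"
      using card_common_deletions_append_ge[of s u v k c] m by (simp only: of_nat_le_iff) 
    finally show ?thesis by (simp add: A_def algebra_simps power_mult_distrib)
  qed
  ultimately show ?thesis using that wd[OF u] wd[OF v] by blast
qed

section \<open>A witness length independent of the alphabet, and the final estimate\<close>

lemma finite_words: "finite (words q n)"
  unfolding words_def by (rule finite_lists_length_eq) simp

lemma words_mono: "q \<le> q' \<Longrightarrow> words q n \<subseteq> words q' n"
  by (auto simp: words_def)

text \<open>A pair witnessing feasibility over the smallest possible alphabet serves for every larger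
  alphabet, so its length can be bounded in terms of \<open>s\<close> and \<open>m\<close> alone.\<close>

lemma deletion_feasible_uniform:
  obtains L where "\<And>q. deletion_feasible q s m \<Longrightarrow> \<exists>u\<in>words q L. \<exists>v\<in>words q L. s \<le> L \<and>
    deletions (s - 1) u \<inter> deletions (s - 1) v = {} \<and> card (deletions s u \<inter> deletions s v) = m"
proof (cases "\<exists>q. deletion_feasible q s m")
  case True
  define q0 where "q0 = (LEAST q. deletion_feasible q s m)"
  have "deletion_feasible q0 s m" unfolding q0_def using True by (rule LeastI_ex)
  then obtain L u v where L: "s \<le> L" and u: "u \<in> words q0 L" and v: "v \<in> words q0 L"
    and disj: "deletion_ball q0 (s - 1) u \<inter> deletion_ball q0 (s - 1) v = {}"
    and m: "card (deletion_ball q0 s u \<inter> deletion_ball q0 s v) = m"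
    unfolding deletion_feasible_def by blast
  have b: "deletion_ball q0 k w = deletions k w" if "k \<le> s" "w \<in> words q0 L" for k w
    using deletion_ball_eq_deletions[OF that(2)] that(1) L by simp
  have "\<exists>u\<in>words q L. \<exists>v\<in>words q L. s \<le> L \<and>
    deletions (s - 1) u \<inter> deletions (s - 1) v = {} \<and> card (deletions s u \<inter> deletions s v) = m"
    if "deletion_feasible q s m" for q
  proof -
    have "q0 \<le> q" unfolding q0_def using that by (rule Least_le)
    then have "u \<in> words q L" "v \<in> words q L" using u v words_mono by blast+
    then show ?thesis using L disj m b u v by auto
  qed
  then show ?thesis using that by blast
qed (use that in blast)

theorem theorem1p7:
  fixes s t m :: nat
  assumes "1 \<le> s" and "s \<le> t"
  shows "\<exists>C::real. \<forall>(\<gamma>::real) (q::nat).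
    0 < \<gamma> \<and> \<gamma> \<le> 1 \<and> 2 \<le> q \<and> deletion_feasible q s m \<longrightarrow>
    (\<forall>\<^sub>F n in sequentially.
      \<bar>real (Max {card (deletion_ball q t x \<inter> deletion_ball q t y) | x y.
                x \<in> words q n \<and> y \<in> words q n \<and>
                real (num_runs x) \<le> \<gamma> * real n \<and> real (num_runs y) \<le> \<gamma> * real n \<and>
                card (deletion_ball q s x \<inter> deletion_ball q s y) \<le> m})
        - real m * \<gamma> ^ (t - s) / fact (t - s) * real n ^ (t - s)\<bar>
      \<le> C * real n powi (int t - int s - 1))"
proof -
  obtain L where L: "\<And>q. deletion_feasible q s m \<Longrightarrow> \<exists>u\<in>words q L. \<exists>v\<in>words q L. s \<le> L \<and>
    deletions (s - 1) u \<inter> deletions (s - 1) v = {} \<and> card (deletions s u \<inter> deletions s v) = m"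
    using deletion_feasible_uniform by blast
  define k where "k = t - s"
  have t: "t = s + k" using assms k_def by simp
  \<comment> \<open>Upper and lower error coefficients. Since \<open>L\<close> was fixed before
    \<open>q\<close>, both depend on \<open>s\<close>, \<open>t\<close> and \<open>m\<close>
    only.\<close>
  define C1 where "C1 = real m * k * k * 2 ^ k + t * 4 ^ t * 2 ^ t"
  define C2 where "C2 = real m * k * (L + 2 * k + 2)"
  have C: "0 \<le> C1" "0 \<le> C2" by (auto simp: C1_def C2_def)
  \<comment> \<open>An integer exponent: for \<open>t = s\<close> it is -1, otherwise it is the
    natural number \<open>k - 1\<close>.\<close>
  define pw where "pw n = real n powi (int t - int s - 1)" for n :: nat
  have pw0: "0 \<le> pw n" for n by (simp add: pw_def)
  have pwk: "pw n = real n ^ (k - 1)" if "0 < k" for n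
  proof -
    have "int t - int s - 1 = int (k - 1)" using that t by simp
    then show ?thesis unfolding pw_def by (simp only: power_int_of_nat)
  qed
  let ?V = "\<lambda>\<gamma> q n. {card (deletion_ball q t x \<inter> deletion_ball q t y) | x y.
                x \<in> words q n \<and> y \<in> words q n \<and>
                real (num_runs x) \<le> \<gamma> * real n \<and> real (num_runs y) \<le> \<gamma> * real n \<and>
                card (deletion_ball q s x \<inter> deletion_ball q s y) \<le> m}"
  have "\<bar>real (Max (?V \<gamma> q n)) - m * \<gamma> ^ k / fact k * real n ^ k\<bar> \<le> (C1 + C2) * pw n"
    if \<gamma>: "0 < \<gamma>" "\<gamma> \<le> 1" and q: "2 \<le> q" and feas: "deletion_feasible q s m"
      and n: "real (L + 2 * k + 2) \<le> \<gamma> * n" and tn: "t \<le> n"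
    for \<gamma> :: real and q n :: nat
  proof -
    let ?E = "m * \<gamma> ^ k / fact k * real n ^ k"
    have ball: "deletion_ball q t x = deletions t x" "deletion_ball q s x = deletions s x"
      if "x \<in> words q n" for x
      using deletion_ball_eq_deletions[OF that] tn t by auto
    have "?V \<gamma> q n \<subseteq> (\<lambda>(x, y). card (deletion_ball q t x \<inter> deletion_ball q t y)) ` (words q n \<times> words q n)"
      by auto
    then have fin: "finite (?V \<gamma> q n)"
      by (rule finite_subset) (intro finite_imageI finite_cartesian_product finite_words)
    have upper: "real e \<le> ?E + C1 * pw n" if "e \<in> ?V \<gamma> q n" for e
    proof -
      from that obtain x y where xy: "x \<in> words q n" "y \<in> words q n"
        and rx: "real (runs x) \<le> \<gamma> * n" and cm: "card (deletions s x \<inter> deletions s y) \<le> m"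
        and e: "e = card (deletions t x \<inter> deletions t y)"
        using ball by (auto simp: num_runs_eq)
      show ?thesis
      \<comment> \<open>For \<open>k = 0\<close> the \<open>t\<close>-ball is the
        \<open>s\<close>-ball, so the main term \<open>m\<close> is already an upper bound.\<close>
      proof (cases "k = 0")
        case True
        then have "real e \<le> m" using e cm t by simp
        also have "\<dots> \<le> ?E + C1 * pw n" using True C pw0 by simp
        finally show ?thesis .
      next
        case False
        have "length x = n" "length y = n" using xy by (auto simp: words_def)
        from card_common_deletions_asymp_upper[OF this cm _ tn \<gamma> rx] False t
        show ?thesis by (simp add: e C1_def pwk)
      qed
    qed
    obtain u v where uv: "u \<in> words q L" "v \<in> words q L" "s \<le> L"
      "deletions (s - 1) u \<inter> deletions (s - 1) v = {}" "card (deletions s u \<inter> deletions s v) = m"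
      using L[OF feas] by blast
    obtain x y where xy: "x \<in> words q n" "y \<in> words q n" "runs x \<le> \<gamma> * n" "runs y \<le> \<gamma> * n"
      "card (deletions s x \<inter> deletions s y) \<le> m"
      and lower: "?E - real (m * k * (L + 2 * k + 2)) * real n ^ (k - 1)
        \<le> card (deletions (s + k) x \<inter> deletions (s + k) y)"
      by (rule ex_common_deletions_asymp_lower[OF uv(1-3) assms(1) q uv(4,5) \<gamma> n])
    let ?e = "card (deletion_ball q t x \<inter> deletion_ball q t y)"
    have mem: "?e \<in> ?V \<gamma> q n"
    proof -
      have "real (num_runs x) \<le> \<gamma> * n" "real (num_runs y) \<le> \<gamma> * n"
        "card (deletion_ball q s x \<inter> deletion_ball q s y) \<le> m"
        using xy ball by (simp_all add: num_runs_eq)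
      then show ?thesis using xy(1,2) by blast
    qed
    have "?E - C2 * pw n \<le> ?e"
    \<comment> \<open>For \<open>k = 0\<close> the factor \<open>k\<close> makes \<open>C2\<close>
      vanish, and the witnesses attain at least \<open>m\<close>.\<close>
    proof (cases "k = 0")
      case True
      then show ?thesis using lower ball xy(1,2) t by (simp add: C2_def)
    next
      case False
      then show ?thesis using lower ball xy(1,2) t by (simp add: C2_def pwk algebra_simps)
    qed
    moreover have "?e \<le> Max (?V \<gamma> q n)" using fin mem by (rule Max_ge)
    moreover have "real (Max (?V \<gamma> q n)) \<le> ?E + C1 * pw n"
      using upper Max_in[OF fin] mem by blast
    moreover have "0 \<le> C1 * pw n" "0 \<le> C2 * pw n" using C pw0 by simp_all
    ultimately show ?thesis unfolding distrib_right abs_le_iff by linarith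
  qed
  note bound = this
  have "\<forall>\<^sub>F n in sequentially.
      \<bar>real (Max (?V \<gamma> q n)) - m * \<gamma> ^ k / fact k * real n ^ k\<bar> \<le> (C1 + C2) * pw n"
    if h: "0 < \<gamma>" "\<gamma> \<le> 1" "2 \<le> q" "deletion_feasible q s m"
    for \<gamma> :: real and q :: nat
  proof -
    \<comment> \<open>The threshold may depend on \<open>\<gamma>\<close>; the constant does
      not.\<close>
    have "\<forall>\<^sub>F n in sequentially. nat \<lceil>real (L + 2 * k + 2) / \<gamma>\<rceil> \<le> n \<and> t \<le> n"
      by (intro eventually_conj eventually_ge_at_top)
    then show ?thesis
    proof (rule eventually_mono)
      fix n assume n: "nat \<lceil>real (L + 2 * k + 2) / \<gamma>\<rceil> \<le> n \<and> t \<le> n"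
      then have "real (L + 2 * k + 2) / \<gamma> \<le> n" by linarith
      then have "real (L + 2 * k + 2) \<le> \<gamma> * n" using h(1) by (simp add: divide_le_eq mult.commute)
      then show "\<bar>real (Max (?V \<gamma> q n)) - m * \<gamma> ^ k / fact k * real n ^ k\<bar> \<le> (C1 + C2) * pw n"
        using bound[OF h] n by blast
    qed
  qed
  then show ?thesis unfolding pw_def k_def by (intro exI[of _ "C1 + C2"]) blast
qed

end
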